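(* Let $\mathcal{K}=\{(0,0)\}$ (the origin, as a one-letter word), let $r=\emptyset$ be the empty word, and let $\mathcal{U}=\{[a,b]\times\{c\}\;|\;a,b,c\in\mathbb{R},\ a<b\}$ be the set system of proper horizontal segments in the plane. There exists a general $\mathrm{EC}(\mathcal{U})$ $T$ constructing $\mathcal{K}$ (the origin) from $r$ (from nothing).
   Context: For a set (alphabet) $A$, $A^*$ is the set of finite words over $A$, including the empty word $\emptyset$. A rooted tree $T=(r,V,E)$ consists of a vertex set $V$, a root $r\in V$ and edges $E\subset V\times V$ such that for every $u\in V$ there is a unique walk from $r$ to $u$; if $(u,v)\in E$ then $v$ is a child of $u$; a leaf is a vertex with no child; a branch is a maximal (finite or infinite) walk; it starts at $r$ and either ends in a leaf or is infinite. $\mathcal{P}=\mathbb{R}^2$ is the set of points, $\mathcal{L}$ the set of lines in $\mathbb{R}^2$, $\mathcal{C}$ the set of circles of positive radius in $\mathbb{R}^2$; elements of $\mathcal{L}\cup\mathcal{C}$ are called curves. For points $a\ne b$, $l(a,b)$ is the line through $a,b$. For points $a$ and $b\neq c$, $k(a,b,c)$ is the circle with center $a$ and radius $|bc|$; moreover $k(a,b,b)=a\in\mathcal{P}$. Let $\mathcal{S}$ be a set of nonempty subsets of $\mathbb{R}^2$ with $(\mathcal{P}\cup\mathcal{L}\cup\mathcal{C})\cap\mathcal{S}=\emptyset$. An $\mathrm{EC}(\mathcal{S})$ (Euclidean construction with $\mathcal{S}$-arbitrary points) is a rooted tree $T=(r,V,E)$ with $V\subset(\mathcal{P}\cup\mathcal{L}\cup\mathcal{C}\cup\mathcal{S})^*$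 and $r\in(\mathcal{P}\cup\mathcal{L}\cup\mathcal{C})^*$, in which the children of each vertex $u=a_1a_2\dots a_m$, $m\ge0$, are determined by exactly one of the following rules (the rule and the choices in it may vary from vertex to vertex); in rules 1–5, $u$ is deterministic, i.e. $m=0$ or $a_m\notin\mathcal{S}$. 1. $u$ is a leaf. 2. $u$ has exactly one child $a_1\dots a_ma_{m+1}$, where $a_{m+1}=l(a_i,a_j)$ for some $1\le i<j\le m$ with $a_i,a_j\in\mathcal{P}$, $a_i\ne a_j$. 3. $u$ has exactly one child $a_1\dots a_ma_{m+1}$, where $a_{m+1}=k(a_i,a_j,a_k)$ for some $1\le i,j,k\le m$ with $a_i,a_j,a_k\in\mathcal{P}$. 4. $u$ has exactly one child $a_1\dots a_ma_{m+1}$, where $a_{m+1}\in\mathcal{P}$ is an intersection point of two curves $a_i\ne a_j$, $1\le i<j\le m$. 5. $u$ has exactly one child $a_1\dots a_ma_{m+1}$, where $a_{m+1}\in\mathcal{S}$. 6. $m\ge1$, $a_m\in\mathcal{S}$ ($u$ is non-deterministic) and the children of $u$ are exactly the words $a_1\dots a_ma_{m+1}$, one for each point $a_{m+1}\in a_m$. A general construction is one in which all these rules are allowed (both compass and straightedge). $T$ is terminating if all its branches are finite. For $\mathcal{K}\subset(\mathcal{P}\cup\mathcal{L}\cup\mathcal{C})^*$, $T=(r,V,E)$ constructs $\mathcal{K}$ from $r$ if $T$ is a terminating $\mathrm{EC}(\mathcal{S})$ with root $r$ such that every leaf $a_1\dots a_m$ of $T$ has a final segment $a_ja_{j+1}\dots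 a_m\in\mathcal{K}$. *)

theory Defs
  imports "HOL-Analysis.Analysis"
begin

section \<open>Rooted trees\<close>

record 'v rooted_tree =
  tree_root :: 'v
  tree_verts :: "'v set"
  tree_edges :: "('v \<times> 'v) set"

definition walk :: "'v rooted_tree \<Rightarrow> 'v \<Rightarrow> 'v list \<Rightarrow> 'v \<Rightarrow> bool" where
  "walk T u xs v \<longleftrightarrow>
     xs \<noteq> [] \<and> hd xs = u \<and> last xs = v \<and> set xs \<subseteq> tree_verts T \<and>
     successively (\<lambda>x y. (x, y) \<in> tree_edges T) xs"

definition is_rooted_tree :: "'v rooted_tree \<Rightarrow> bool" where
  "is_rooted_tree T \<longleftrightarrow>
     tree_root T \<in> tree_verts T \<and>
     tree_edges T \<subseteq> tree_verts T \<times> tree_verts T \<and>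
     (\<forall>u\<in>tree_verts T. \<exists>!xs. walk T (tree_root T) xs u)"

definition children :: "'v rooted_tree \<Rightarrow> 'v \<Rightarrow> 'v set" where
  "children T u = {v. (u, v) \<in> tree_edges T}"

definition leaf :: "'v rooted_tree \<Rightarrow> 'v \<Rightarrow> bool" where
  "leaf T u \<longleftrightarrow> u \<in> tree_verts T \<and> children T u = {}"

text \<open>In a rooted tree the infinite maximal walks are exactly the infinite walks
  starting at the root.\<close>

definition infinite_branch :: "'v rooted_tree \<Rightarrow> (nat \<Rightarrow> 'v) \<Rightarrow> bool" where
  "infinite_branch T b \<longleftrightarrow>
     b 0 = tree_root T \<and> (\<forall>n. (b n, b (Suc n)) \<in> tree_edges T)"

definition terminating :: "'v rooted_tree \<Rightarrow> bool" where
  "terminating T \<longleftrightarrow> \<not> (\<exists>b. infinite_branch T b)"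


section \<open>Points, lines, circles\<close>

text \<open>The plane is \<open>real \<times> real\<close>, whose library distance is the Euclidean one.
  A letter of the alphabet is a point or a set of points; a point is
  never identified with a set, so points and members of \<open>\<S>\<close> are distinct by typing.\<close>

type_synonym point = "real \<times> real"

datatype letter = Point point | Figure "point set"

type_synonym word = "letter list"

definition line :: "point \<Rightarrow> point \<Rightarrow> point set" where
  "line a b = affine hull {a, b}"

definition lines :: "point set set" where
  "lines = {line a b | a b. a \<noteq> b}"

definition circles :: "point set set" where
  "circles = {sphere a \<rho> | a \<rho>. \<rho> > 0}"

definition curves :: "point set set" where
  "curves = lines \<union> circles"

definition compass :: "point \<Rightarrow> point \<Rightarrow> point \<Rightarrow> letter" where
  "compass a b c = (if b = c then Point a else Figure (sphere a (dist b c)))"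

definition basic_letters :: "letter set" where
  "basic_letters = range Point \<union> Figure ` curves"


section \<open>Euclidean constructions with arbitrary points\<close>

definition admissible :: "point set set \<Rightarrow> bool" where
  "admissible \<S> \<longleftrightarrow> {} \<notin> \<S> \<and> curves \<inter> \<S> = {}"

definition deterministic :: "point set set \<Rightarrow> word \<Rightarrow> bool" where
  "deterministic \<S> u \<longleftrightarrow> u = [] \<or> last u \<notin> Figure ` \<S>"

text \<open>The letters that may be appended to \<open>u\<close> as the single child; indices are
  0-based.\<close>

definition straightedge_step :: "word \<Rightarrow> letter \<Rightarrow> bool" where
  "straightedge_step u x \<longleftrightarrow>
     (\<exists>i j a b. i < j \<and> j < length u \<and> u ! i = Point a \<and> u ! j = Point b \<and> a \<noteq> b \<and>
        x = Figure (line a b))"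

definition compass_step :: "word \<Rightarrow> letter \<Rightarrow> bool" where
  "compass_step u x \<longleftrightarrow>
     (\<exists>i j k a b c. i < length u \<and> j < length u \<and> k < length u \<and>
        u ! i = Point a \<and> u ! j = Point b \<and> u ! k = Point c \<and>
        x = compass a b c)"

definition intersection_step :: "word \<Rightarrow> letter \<Rightarrow> bool" where
  "intersection_step u x \<longleftrightarrow>
     (\<exists>i j A B p. i < j \<and> j < length u \<and> u ! i = Figure A \<and> u ! j = Figure B \<and>
        A \<in> curves \<and> B \<in> curves \<and> A \<noteq> B \<and> p \<in> A \<inter> B \<and> x = Point p)"

definition choose_set_step :: "point set set \<Rightarrow> letter \<Rightarrow> bool" where
  "choose_set_step \<S> x \<longleftrightarrow> x \<in> Figure ` \<S>"

text \<open>A vertex may satisfy the conditions of several rules (a point produced by a degenerate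
  compass step may also be an intersection point); what matters is that
  its set of children is the one prescribed by some rule.\<close>

definition EC_rule :: "point set set \<Rightarrow> word \<Rightarrow> word set \<Rightarrow> bool" where
  "EC_rule \<S> u C \<longleftrightarrow>
     deterministic \<S> u \<and>
       (C = {} \<or>
        (\<exists>x. C = {u @ [x]} \<and>
           (straightedge_step u x \<or> compass_step u x \<or> intersection_step u x \<or>
            choose_set_step \<S> x))) \<or>
     (\<exists>A\<in>\<S>. u \<noteq> [] \<and> last u = Figure A \<and> C = {u @ [Point p] | p. p \<in> A})"

text \<open>General constructions: both the straightedge and the compass rules may be used.\<close>

definition EC :: "point set set \<Rightarrow> word rooted_tree \<Rightarrow> bool" where
  "EC \<S> T \<longleftrightarrow>
     admissible \<S> \<and>
     is_rooted_tree T \<and>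
     tree_verts T \<subseteq> lists (basic_letters \<union> Figure ` \<S>) \<and>
     tree_root T \<in> lists basic_letters \<and>
     (\<forall>u\<in>tree_verts T. EC_rule \<S> u (children T u))"

definition constructs :: "point set set \<Rightarrow> word rooted_tree \<Rightarrow> word set \<Rightarrow> word \<Rightarrow> bool" where
  "constructs \<S> T K r \<longleftrightarrow>
     K \<subseteq> lists basic_letters \<and>
     EC \<S> T \<and> terminating T \<and> tree_root T = r \<and>
     (\<forall>u. leaf T u \<longrightarrow> (\<exists>j<length u. drop j u \<in> K))"

definition horizontal_segments :: "point set set" where
  "horizontal_segments = {{a..b} \<times> {c} | a b c. a < b}"

end

theory Submission
  imports Defs
begin

text \<open>
  Two free points on \<open>y = 0\<close> give points \<open>(x\<^sub>1,0) \<noteq> (x\<^sub>2,0)\<close> and the \<open>x\<close>-axis. The segments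
  are chosen so that \<open>R = x\<^sub>2 - x\<^sub>1\<close> exceeds \<open>\<bar>x\<^sub>1\<bar>\<close>, hence the circle of radius \<open>R\<close> around
  \<open>(x\<^sub>1,0)\<close> meets the \<open>y\<close>-axis in \<open>(0,h)\<close>, where \<open>h = sqrt (R\<^sup>2 - x\<^sub>1\<^sup>2)\<close>. The next segments
  may depend on the points found so far, so two further free points on \<open>y = h\<close>
  give that line, and intersecting it with the circle gives \<open>(0,h)\<close>.
  Reflecting \<open>(0,h)\<close> in the \<open>x\<close>-axis gives the \<open>y\<close>-axis and thereby the origin.
\<close>

section \<open>Trees of words\<close>

text \<open>Each edge appends one letter, so a walk can only run through the successive prefixes of
  its end word. Its end therefore determines it, which is the uniqueness a rooted tree
  requires.\<close>

lemma walk_words_eq: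
  assumes "\<And>u v. (u, v) \<in> tree_edges T \<Longrightarrow> \<exists>x. v = u @ [x]"
    and "walk T r xs u"
  shows "length r \<le> length u \<and> xs = map (\<lambda>k. take k u) [length r..<Suc (length u)]"
  using assms(2)
proof (induction xs arbitrary: u rule: rev_induct)
  case Nil
  then show ?case by (simp add: walk_def)
next
  case (snoc w xs)
  show ?case
  proof (cases "xs = []")
    case True
    with snoc.prems have "u = r" by (auto simp: walk_def)
    with snoc.prems True show ?thesis by (simp add: walk_def del: upt_Suc) (simp add: upt_rec)
  next
    case False
    from snoc.prems have "w = u" by (simp add: walk_def)
    have "walk T r xs (last xs)" and "(last xs, u) \<in> tree_edges T"
      using snoc.prems False by (auto simp: walk_def successively_append_iff)
    then obtain x where u: "u = last xs @ [x]"
      and len: "length r \<le> length (last xs)"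
      and xs: "xs = map (\<lambda>k. take k (last xs)) [length r..<Suc (length (last xs))]"
      using assms(1) snoc.IH by blast
    have "map (\<lambda>k. take k u) [length r..<Suc (length (last xs))] = xs"
      by (subst xs) (auto simp: u)
    with \<open>w = u\<close> len u show ?thesis by simp
  qed
qed

lemma is_rooted_tree_words:
  assumes "\<And>u v. (u, v) \<in> E \<Longrightarrow> \<exists>x. v = u @ [x]"
  shows "is_rooted_tree \<lparr>tree_root = r, tree_verts = E\<^sup>* `` {r},
      tree_edges = E \<inter> (E\<^sup>* `` {r}) \<times> (E\<^sup>* `` {r})\<rparr>"
    (is "is_rooted_tree ?T")
proof -
  have "\<exists>xs. walk ?T r xs u" if "(r, u) \<in> E\<^sup>*" for u
    using that
  proof (induction rule: rtrancl_induct)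
    case base
    have "walk ?T r [r] r" by (simp add: walk_def)
    then show ?case ..
  next
    case (step u v)
    then obtain xs where "walk ?T r xs u" by blast
    with step have "walk ?T r (xs @ [v]) v"
      by (auto simp: walk_def successively_append_iff)
    then show ?case ..
  qed
  moreover have "xs = ys" if "walk ?T r xs u" "walk ?T r ys u" for xs ys u
    using walk_words_eq[of ?T r xs u] walk_words_eq[of ?T r ys u] that assms by simp
  ultimately show ?thesis
    by (auto simp: is_rooted_tree_def)
qed

section \<open>Constructions of bounded depth\<close>

text \<open>Encodes a construction tree below \<open>u\<close> whose branches all have exactly
  \<open>n\<close> further edges; \<open>C \<noteq> {}\<close> excludes earlier leaves. Since
  \<open>C\<close> depends on \<open>u\<close>, later choices can use earlier free points.
  Determinism in the base case makes the leaf rule applicable.\<close>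

primrec forces :: "point set set \<Rightarrow> word set \<Rightarrow> nat \<Rightarrow> word \<Rightarrow> bool" where
  "forces \<S> K 0 u \<longleftrightarrow> deterministic \<S> u \<and> (\<exists>j<length u. drop j u \<in> K)"
| "forces \<S> K (Suc n) u \<longleftrightarrow> (\<exists>C. C \<noteq> {} \<and> EC_rule \<S> u C \<and> (\<forall>v\<in>C. forces \<S> K n v))"

lemma line_in_curves: "a \<noteq> b \<Longrightarrow> line a b \<in> curves"
  unfolding curves_def lines_def by blast

lemma sphere_in_curves: "0 < \<rho> \<Longrightarrow> sphere a \<rho> \<in> curves"
  unfolding curves_def circles_def by blast

lemma EC_rule_child:
  assumes "EC_rule \<S> u C" "v \<in> C"
  shows "\<exists>x \<in> basic_letters \<union> Figure ` \<S>. v = u @ [x]"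
  using assms
  by (auto simp: EC_rule_def straightedge_step_def compass_step_def intersection_step_def
      choose_set_step_def compass_def basic_letters_def line_in_curves sphere_in_curves
      split: if_splits)

text \<open>Choice fixes one set of children for each word and remaining depth; the words reachable
  from \<open>r\<close> then form the tree. Their bounded length makes it terminating.\<close>

lemma forces_imp_constructs:
  assumes "admissible \<S>" "K \<subseteq> lists basic_letters" "r \<in> lists basic_letters"
    and "forces \<S> K N r"
  shows "\<exists>T. constructs \<S> T K r"
proof -
  have "\<forall>n u. \<exists>C. forces \<S> K (Suc n) u \<longrightarrow>
      C \<noteq> {} \<and> EC_rule \<S> u C \<and> (\<forall>v\<in>C. forces \<S> K n v)"
    by auto
  then obtain sel where sel: "\<And>n u. forces \<S> K (Suc n) u \<Longrightarrow>
      sel n u \<noteq> {} \<and> EC_rule \<S> u (sel n u) \<and> (\<forall>v\<in>sel n u. forces \<S> K n v)"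
    by metis
  note forces.simps(2) [simp del]
  \<comment> \<open>\<open>M\<close> is the length of every leaf, so the remaining depth of a vertex
    can be read off its length.\<close>
  define M where "M = length r + N"
  define E where "E = {(u, v). \<exists>n. M = Suc n + length u \<and> forces \<S> K (Suc n) u \<and> v \<in> sel n u}"
  define V where "V = E\<^sup>* `` {r}"
  define T where "T = \<lparr>tree_root = r, tree_verts = V, tree_edges = E \<inter> V \<times> V\<rparr>"
  have E_child: "\<exists>x \<in> basic_letters \<union> Figure ` \<S>. v = u @ [x]" if "(u, v) \<in> E" for u v
  proof -
    from that obtain n where "forces \<S> K (Suc n) u" "v \<in> sel n u"
      by (auto simp: E_def)
    with sel[of n u] show ?thesis
      by (intro EC_rule_child[of \<S> u "sel n u" v]) simp_all
  qed
  have tree: "is_rooted_tree T"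
    unfolding T_def V_def by (rule is_rooted_tree_words) (use E_child in blast)
  have V: "u \<in> lists (basic_letters \<union> Figure ` \<S>) \<and> (\<exists>n. M = n + length u \<and> forces \<S> K n u)"
    if "u \<in> V" for u
  proof -
    have "(r, u) \<in> E\<^sup>*" using that by (simp add: V_def)
    then show ?thesis
    proof (induction rule: rtrancl_induct)
      case base
      with assms show ?case by (auto simp: M_def)
    next
      case (step u v)
      from E_child[OF step(2)] obtain x where "x \<in> basic_letters \<union> Figure ` \<S>" "v = u @ [x]"
        by blast
      moreover obtain n where "M = Suc n + length u" "forces \<S> K n v"
        using step(2) sel by (auto simp: E_def)
      ultimately show ?case using step.IH by auto
    qed
  qed
  \<comment> \<open>Reachable words are closed under \<open>E\<close>, so restricting the edges to
    \<open>V\<close> loses no child.\<close>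
  have children: "children T u = E `` {u}" if "u \<in> V" for u
    using that by (auto simp: children_def T_def V_def intro: rtrancl_into_rtrancl)
  have children_0: "children T u = {}" if "u \<in> V" "M = length u" for u
    using that children by (auto simp: E_def)
  have children_Suc: "children T u = sel n u"
    if "u \<in> V" "M = Suc n + length u" "forces \<S> K (Suc n) u" for u n
    using that children by (auto simp: E_def)
  have rule: "EC_rule \<S> u (children T u) \<and>
      (children T u = {} \<longrightarrow> (\<exists>j<length u. drop j u \<in> K))" if u: "u \<in> V" for u
  proof -
    obtain n where n: "M = n + length u" "forces \<S> K n u"
      using V[OF u] by blast
    show ?thesis
    proof (cases n)
      case 0
      with n u children_0[of u] show ?thesis
        by (simp add: EC_rule_def)
    next
      case (Suc m)
      with n u children_Suc[of u m] sel[of m u] show ?thesis by simp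
    qed
  qed
  have "terminating T"
    unfolding terminating_def
  proof
    assume "\<exists>b. infinite_branch T b"
    then obtain b where b: "\<And>n. (b n, b (Suc n)) \<in> E \<inter> V \<times> V"
      by (auto simp: infinite_branch_def T_def)
    \<comment> \<open>Lengths grow by one along a branch, whereas no vertex is longer than
      \<open>M\<close>.\<close>
    have "length (b (Suc n)) = Suc (length (b n))" for n
      using E_child[of "b n" "b (Suc n)"] b[of n] by auto
    then have "n \<le> length (b n)" for n
      by (induction n) simp_all
    from this[of "Suc M"]
    have "Suc M \<le> length (b (Suc M))" .
    moreover have "length (b (Suc M)) \<le> M"
      using V[of "b (Suc M)"] b[of M] by auto
    ultimately show False by simp
  qed
  moreover have "EC \<S> T"
    unfolding EC_def using assms tree V rule by (auto simp: T_def)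
  moreover have "\<exists>j<length u. drop j u \<in> K" if "leaf T u" for u
    using that rule by (auto simp: leaf_def T_def)
  moreover have "tree_root T = r" by (simp add: T_def)
  ultimately show ?thesis
    using assms unfolding constructs_def by blast
qed

section \<open>Single construction steps as rules for \<open>forces\<close>\<close>

definition ends_basic :: "word \<Rightarrow> bool" where
  "ends_basic u \<longleftrightarrow> u = [] \<or> last u \<in> basic_letters"

lemma Point_basic [simp]: "Point p \<in> basic_letters"
  by (simp add: basic_letters_def)

lemma Figure_basic [simp]: "Figure A \<in> basic_letters \<longleftrightarrow> A \<in> curves"
  by (auto simp: basic_letters_def)

lemma deterministic_ends_basic:
  assumes "admissible \<S>" "ends_basic u"
  shows "deterministic \<S> u"
  using assms by (auto simp: admissible_def ends_basic_def deterministic_def basic_letters_def)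

lemma forces_step:
  assumes "admissible \<S>" "ends_basic u"
    and "straightedge_step u x \<or> compass_step u x \<or> intersection_step u x"
    and "forces \<S> K n (u @ [x])"
  shows "forces \<S> K (Suc n) u"
proof -
  have "EC_rule \<S> u {u @ [x]}"
    using assms deterministic_ends_basic[of \<S> u] by (auto simp: EC_rule_def)
  with assms show ?thesis
    unfolding forces.simps by (intro exI[of _ "{u @ [x]}"]) simp
qed

text \<open>Membership in the word suffices: distinct points sit at distinct indices, and
  \<open>line\<close> is symmetric, so the order of the indices is irrelevant.\<close>

lemma forces_line:
  assumes "admissible \<S>" "ends_basic u" "Point a \<in> set u" "Point b \<in> set u" "a \<noteq> b"
    and "forces \<S> K n (u @ [Figure (line a b)])"
  shows "forces \<S> K (Suc n) u"
proof -
  obtain i j where ij: "i < length u" "j < length u" "u ! i = Point a" "u ! j = Point b"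
    using assms by (auto simp: in_set_conv_nth)
  with assms have "i \<noteq> j" by auto
  moreover have "line a b = line b a" by (simp add: line_def insert_commute)
  ultimately have "straightedge_step u (Figure (line a b))"
    unfolding straightedge_step_def using ij assms by (metis linorder_neqE_nat)
  then show ?thesis using assms forces_step by blast
qed

lemma forces_circle:
  assumes "admissible \<S>" "ends_basic u" "Point a \<in> set u" "Point b \<in> set u" "a \<noteq> b"
    and "forces \<S> K n (u @ [Figure (sphere a (dist a b))])"
  shows "forces \<S> K (Suc n) u"
proof -
  obtain i j where ij: "i < length u" "j < length u" "u ! i = Point a" "u ! j = Point b"
    using assms by (auto simp: in_set_conv_nth)
  have "compass_step u (compass a a b)"
    unfolding compass_step_def using ij by blast
  then have "compass_step u (Figure (sphere a (dist a b)))"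
    using assms by (simp add: compass_def)
  then show ?thesis using assms forces_step by blast
qed

lemma forces_intersection:
  assumes "admissible \<S>" "ends_basic u" "Figure A \<in> set u" "Figure B \<in> set u"
    "A \<in> curves" "B \<in> curves" "A \<noteq> B" "p \<in> A" "p \<in> B"
    and "forces \<S> K n (u @ [Point p])"
  shows "forces \<S> K (Suc n) u"
proof -
  obtain i j where ij: "i < length u" "j < length u" "u ! i = Figure A" "u ! j = Figure B"
    using assms by (auto simp: in_set_conv_nth)
  with assms have "i \<noteq> j" by auto
  then have "intersection_step u (Point p)"
    unfolding intersection_step_def using ij assms by (metis IntI linorder_neqE_nat)
  then show ?thesis using assms forces_step by blast
qed

text \<open>Choosing a set and branching over its points are merged into one step of depth two.
  Admissibility makes the set nonempty, so the branching does not produce a leaf.\<close>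

lemma forces_arbitrary:
  assumes "admissible \<S>" "ends_basic u" "A \<in> \<S>"
    and "\<And>p. p \<in> A \<Longrightarrow> forces \<S> K n (u @ [Figure A, Point p])"
  shows "forces \<S> K (Suc (Suc n)) u"
proof -
  have "A \<noteq> {}" using assms by (auto simp: admissible_def)
  then have "forces \<S> K (Suc n) (u @ [Figure A])"
    using assms unfolding forces.simps EC_rule_def
    by (intro exI[of _ "{(u @ [Figure A]) @ [Point p] | p. p \<in> A}"]) auto
  moreover have "EC_rule \<S> u {u @ [Figure A]}"
    using assms deterministic_ends_basic[of \<S> u] by (auto simp: EC_rule_def choose_set_step_def)
  ultimately show ?thesis
    unfolding forces.simps(2)[of _ _ "Suc n"] by (intro exI[of _ "{u @ [Figure A]}"]) simp
qed

section \<open>The origin from horizontal segments\<close>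

lemma line_iff:
  "(x, y) \<in> line (a, b) (c, d) \<longleftrightarrow> (\<exists>t. x = a + t * (c - a) \<and> y = b + t * (d - b))"
  by (auto simp: line_def affine_hull_2_alt algebra_simps image_iff)

lemma affine_parameter:
  fixes a b x :: real
  assumes "a \<noteq> b"
  shows "\<exists>t. x = a + t * (b - a)"
  using assms by (intro exI[of _ "(x - a) / (b - a)"]) simp

lemma horizontal_line: "a \<noteq> b \<Longrightarrow> line (a, c) (b, c) = UNIV \<times> {c}"
  by (auto simp: line_iff affine_parameter)

lemma vertical_line: "a \<noteq> b \<Longrightarrow> line (c, a) (c, b) = {c} \<times> UNIV"
  by (auto simp: line_iff affine_parameter)

lemma admissible_horizontal_segments: "admissible horizontal_segments"
proof -
  have "line p q \<noteq> {a..b} \<times> {c}" if "p \<noteq> q" for p q :: point and a b c :: real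
  proof
    assume eq: "line p q = {a..b} \<times> {c}"
    obtain p1 p2 q1 q2 where pq: "p = (p1, p2)" "q = (q1, q2)" by fastforce
    have *: "p1 + t * (q1 - p1) \<in> {a..b} \<and> p2 + t * (q2 - p2) = c" for t
    proof -
      have "(p1 + t * (q1 - p1), p2 + t * (q2 - p2)) \<in> line p q"
        unfolding pq line_iff by blast
      with eq show ?thesis by simp
    qed
    \<comment> \<open>The parameters 0 and 1 give \<open>p\<close> and \<open>q\<close> themselves,
      which thus have the same height.\<close>
    have "p2 = q2" using *[of 0] *[of 1] by simp
    with that pq have "q1 \<noteq> p1" by auto
    \<comment> \<open>At this parameter the first coordinate is \<open>b + 1\<close>, beyond the
      segment.\<close>
    with *[of "(b + 1 - p1) / (q1 - p1)"] show False by simp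
  qed
  moreover have "sphere p \<rho> \<noteq> {a..b} \<times> {c}" if "\<rho> > 0" for p :: point and \<rho> a b c :: real
  proof
    assume eq: "sphere p \<rho> = {a..b} \<times> {c}"
    obtain p1 p2 where p: "p = (p1, p2)" by fastforce
    \<comment> \<open>The top and bottom points of the circle have different heights.\<close>
    have "(p1, p2 + \<rho>) \<in> sphere p \<rho>" "(p1, p2 - \<rho>) \<in> sphere p \<rho>"
      using that by (auto simp: p dist_Pair_Pair dist_real_def)
    with eq that show False by auto
  qed
  ultimately have "curves \<inter> horizontal_segments = {}"
    unfolding curves_def lines_def circles_def horizontal_segments_def by blast
  moreover have "{} \<notin> horizontal_segments"
    by (force simp: horizontal_segments_def)
  ultimately show ?thesis by (simp add: admissible_def)
qed

text \<open>Both ends of the horizontal diameter of the first circle would be equally far from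
  \<open>x\<^sub>2\<close>, forcing \<open>x\<^sub>2\<close> to be their midpoint
  \<open>x\<^sub>1\<close>.\<close>

lemma sphere_axis_neq:
  fixes x\<^sub>1 x\<^sub>2 r s :: real
  assumes "x\<^sub>1 \<noteq> x\<^sub>2" "0 < r"
  shows "sphere (x\<^sub>1, 0 :: real) r \<noteq> sphere (x\<^sub>2, 0) s"
proof
  assume "sphere (x\<^sub>1, 0 :: real) r = sphere (x\<^sub>2, 0) s"
  moreover have "(x\<^sub>1 + r, 0) \<in> sphere (x\<^sub>1, 0 :: real) r" "(x\<^sub>1 - r, 0) \<in> sphere (x\<^sub>1, 0 :: real) r"
    using assms by (auto simp: dist_Pair_Pair dist_real_def)
  ultimately have "\<bar>x\<^sub>2 - (x\<^sub>1 + r)\<bar> = s" "\<bar>x\<^sub>2 - (x\<^sub>1 - r)\<bar> = s"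
    by (auto simp: dist_Pair_Pair dist_real_def)
  with assms show False by linarith
qed

text \<open>The six steps are the x-axis, two circles through \<open>(0, h)\<close>, their second
  common point \<open>(0, -h)\<close>, the y-axis and the origin. As \<open>forces\<close> counts
  the remaining depth, they are verified from last to first.\<close>

lemma forces_origin:
  assumes "admissible \<S>" "ends_basic u" "x\<^sub>1 \<noteq> x\<^sub>2" "h \<noteq> 0"
    and "{Point (x\<^sub>1, 0), Point (x\<^sub>2, 0), Point (0, h)} \<subseteq> set u"
  shows "forces \<S> {[Point (0, 0)]} 6 u"
proof -
  define X Y where "X = line (x\<^sub>1, 0) (x\<^sub>2, 0)" and "Y = line (0, h) (0, -h)"
  define C where "C x = sphere (x :: real, 0 :: real) (dist (x, 0) (0, h))" for x
  have curves: "X \<in> curves" "Y \<in> curves" "C x \<in> curves" for x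
    using assms unfolding X_def Y_def C_def by (auto intro!: line_in_curves sphere_in_curves)
  have "C x\<^sub>1 \<noteq> C x\<^sub>2"
    using assms unfolding C_def by (intro sphere_axis_neq) auto
  have reflected: "(0, -h) \<in> C x" for x
    by (simp add: C_def dist_Pair_Pair dist_real_def)
  have origin: "X \<noteq> Y" "(0, 0) \<in> X" "(0, 0) \<in> Y"
    using assms by (auto simp: X_def Y_def horizontal_line vertical_line)
  define u1 where "u1 = u @ [Figure X]"
  define u2 where "u2 = u1 @ [Figure (C x\<^sub>1)]"
  define u3 where "u3 = u2 @ [Figure (C x\<^sub>2)]"
  define u4 where "u4 = u3 @ [Point (0, -h)]"
  define u5 where "u5 = u4 @ [Figure Y]"
  define u6 where "u6 = u5 @ [Point (0, 0)]"
  note us = u1_def u2_def u3_def u4_def u5_def u6_def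
  have ends: "ends_basic u1" "ends_basic u2" "ends_basic u3" "ends_basic u4" "ends_basic u5"
      "ends_basic u6"
    using curves by (simp_all add: us ends_basic_def)
  let ?F = "forces \<S> {[Point (0, 0)]}"
  have "drop (length u5) u6 \<in> {[Point (0, 0)]}" "length u5 < length u6"
    by (simp_all add: u6_def)
  then have "?F 0 u6"
    using assms ends by (auto intro: deterministic_ends_basic)
  then have "?F (Suc 0) u5"
    using assms ends curves origin
    by (intro forces_intersection[of \<S> u5 X Y "(0, 0)"]) (simp_all add: us)
  then have "?F (Suc (Suc 0)) u4"
    using assms ends by (intro forces_line[of \<S> u4 "(0, h)" "(0, -h)"]) (simp_all add: us Y_def)
  then have "?F (Suc (Suc (Suc 0))) u3"
    using assms ends curves reflected \<open>C x\<^sub>1 \<noteq> C x\<^sub>2\<close>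
    by (intro forces_intersection[of \<S> u3 "C x\<^sub>1" "C x\<^sub>2" "(0, -h)"]) (simp_all add: us)
  then have "?F (Suc (Suc (Suc (Suc 0)))) u2"
    using assms ends
    by (intro forces_circle[of \<S> u2 "(x\<^sub>2, 0)" "(0, h)"]) (simp_all add: us C_def)
  then have "?F (Suc (Suc (Suc (Suc (Suc 0))))) u1"
    using assms ends
    by (intro forces_circle[of \<S> u1 "(x\<^sub>1, 0)" "(0, h)"]) (simp_all add: us C_def)
  then have "?F (Suc (Suc (Suc (Suc (Suc (Suc 0)))))) u"
    using assms
    by (intro forces_line[of \<S> u "(x\<^sub>1, 0)" "(x\<^sub>2, 0)"]) (simp_all add: us X_def)
  then show ?thesis by (simp only: eval_nat_numeral BitM.simps pred_numeral_simps)
qed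

section \<open>The complete construction\<close>

lemma horizontal_segment: "a < b \<Longrightarrow> {a..b} \<times> {c} \<in> horizontal_segments"
  by (auto simp: horizontal_segments_def)

lemma forces_two_on_horizontal:
  assumes "ends_basic u" "a < b" "c < d"
    and "\<And>x y. x \<in> {a..b} \<Longrightarrow> y \<in> {c..d} \<Longrightarrow>
      forces horizontal_segments K n
        (u @ [Figure ({a..b} \<times> {e}), Point (x, e), Figure ({c..d} \<times> {e}), Point (y, e)])"
  shows "forces horizontal_segments K (Suc (Suc (Suc (Suc n)))) u"
proof (rule forces_arbitrary[OF admissible_horizontal_segments assms(1) horizontal_segment[OF assms(2)]])
  fix p :: point assume "p \<in> {a..b} \<times> {e}"
  then obtain x where x: "p = (x, e)" "x \<in> {a..b}" by auto
  let ?u = "u @ [Figure ({a..b} \<times> {e}), Point p]"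
  have "ends_basic ?u" by (simp add: ends_basic_def)
  then show "forces horizontal_segments K (Suc (Suc n)) ?u"
  proof (rule forces_arbitrary[OF admissible_horizontal_segments _ horizontal_segment[OF assms(3)]])
    fix q :: point assume "q \<in> {c..d} \<times> {e}"
    then obtain y where "q = (y, e)" "y \<in> {c..d}" by auto
    with x assms(4) show "forces horizontal_segments K n (?u @ [Figure ({c..d} \<times> {e}), Point q])"
      by simp
  qed
qed

theorem theorem2p14:
  "\<exists>T. constructs horizontal_segments T {[Point (0, 0)]} []"
proof (rule forces_imp_constructs[OF admissible_horizontal_segments])
  let ?F = "forces horizontal_segments {[Point (0, 0)]}"
  note adm = admissible_horizontal_segments
  \<comment> \<open>The eleven steps before \<open>forces_origin\<close> are four for two free
    points, one circle, four for two more free points, one line and one intersection.\<close>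
  show "?F (Suc (Suc (Suc (Suc (Suc (Suc (Suc (Suc (Suc (Suc (Suc 6))))))))))) []"
  \<comment> \<open>With these segments \<open>x\<^sub>2 - x\<^sub>1\<close> is at least 2, while
    \<open>\<bar>x\<^sub>1\<bar>\<close> is at most 1.\<close>
  proof (rule forces_two_on_horizontal[of _ 0 1 3 4 _ _ 0])
    fix x\<^sub>1 x\<^sub>2 :: real
    assume x: "x\<^sub>1 \<in> {0..1}" "x\<^sub>2 \<in> {3..4}"
    define R h where "R = x\<^sub>2 - x\<^sub>1" and "h = sqrt (R\<^sup>2 - x\<^sub>1\<^sup>2)"
    have "x\<^sub>1\<^sup>2 < R\<^sup>2"
      using x by (intro power_strict_mono) (auto simp: R_def)
    then have h: "h > 0" "h\<^sup>2 = R\<^sup>2 - x\<^sub>1\<^sup>2" by (simp_all add: h_def)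
    define C where "C = sphere (x\<^sub>1, 0 :: real) (dist (x\<^sub>1, 0 :: real) (x\<^sub>2, 0))"
    have C: "C \<in> curves" "(0, h) \<in> C"
      using x h unfolding C_def
      by (auto intro!: sphere_in_curves simp: dist_Pair_Pair dist_real_def R_def)
    define u where "u = [] @ [Figure ({0..1} \<times> {0}), Point (x\<^sub>1, 0), Figure ({3..4} \<times> {0}), Point (x\<^sub>2, 0)]"
    have "?F (Suc (Suc (Suc (Suc (Suc (Suc 6)))))) (u @ [Figure C])"
    \<comment> \<open>The height \<open>h\<close> depends on the free points already chosen.
      Disjoint intervals make the two new points distinct.\<close>
    proof (rule forces_two_on_horizontal[of _ 0 1 3 4 _ _ h])
      fix y\<^sub>1 y\<^sub>2 :: real
      assume y: "y\<^sub>1 \<in> {0..1}" "y\<^sub>2 \<in> {3..4}"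
      define v where "v = (u @ [Figure C]) @
        [Figure ({0..1} \<times> {h}), Point (y\<^sub>1, h), Figure ({3..4} \<times> {h}), Point (y\<^sub>2, h)]"
      define L where "L = line (y\<^sub>1, h) (y\<^sub>2, h)"
      have "y\<^sub>1 \<noteq> y\<^sub>2" using y by auto
      then have L: "L \<in> curves" "L = UNIV \<times> {h}"
        using line_in_curves[of "(y\<^sub>1, h)" "(y\<^sub>2, h)"] by (simp_all add: L_def horizontal_line)
      \<comment> \<open>\<open>C\<close> contains a point of height 0, but \<open>L\<close> lies at
        height \<open>h > 0\<close>.\<close>
      have "(x\<^sub>2, 0) \<in> C" "(x\<^sub>2, 0) \<notin> L"
        using h by (auto simp: C_def L)
      then have "L \<noteq> C" by blast
      have "?F 6 (v @ [Figure L] @ [Point (0, h)])"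
        using x h by (intro forces_origin[OF adm, of _ x\<^sub>1 x\<^sub>2 h]) (auto simp: u_def v_def ends_basic_def)
      then have "?F (Suc 6) (v @ [Figure L])"
        using C L \<open>L \<noteq> C\<close>
        by (intro forces_intersection[OF adm, of "v @ [Figure L]" L C "(0, h)"]) (simp_all add: v_def ends_basic_def)
      then show "?F (Suc (Suc 6)) v"
        using y unfolding L_def
        by (intro forces_line[OF adm, of v "(y\<^sub>1, h)" "(y\<^sub>2, h)"]) (auto simp: v_def ends_basic_def)
    qed (simp_all add: C ends_basic_def)
    then show "?F (Suc (Suc (Suc (Suc (Suc (Suc (Suc 6))))))) u"
      using x unfolding C_def
      by (intro forces_circle[OF adm, of u "(x\<^sub>1, 0)" "(x\<^sub>2, 0)"]) (auto simp: u_def ends_basic_def)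
  qed (simp_all add: ends_basic_def)
qed simp_all

end
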